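(* Let $I=\{0,i_1,\dots,i_m\}\subset\mathbb{R}$ be a set of cardinality $m+1$, let $(\omega_i)_{i\in I}$ be a sequence of $m+1$ positive numbers and let $n\geq 2$. Then there exist star bodies $K,L\in\mathcal{S}^n_0$ such that $$\widetilde{\mathrm{W}}_i(K,L)=\omega_i\quad\text{for all } i\in I,$$ if and only if either there exist $0<a<b$ such that $$(\omega_0,\omega_{i_1},\dots,\omega_{i_m})\in\operatorname{int} C_{a,b}^I,$$ or $\omega_i=\lambda^i\omega_0$ for some $\lambda>0$ and every $i\in I$; in this case $L=\lambda K$.
   Context: A star body in $\mathbb{R}^n$ is a nonempty compact set $K\subset\mathbb{R}^n$ which is starshaped with respect to the origin (i.e. $[0,x]\subseteq K$ for all $x\in K$) and whose radial function $\rho_K(u)=\max\{\lambda\ge 0:\lambda u\in K\}$, $u\in\mathbb{S}^{n-1}$, is positive and continuous. $\mathcal{S}^n_0$ denotes the set of all star bodies in $\mathbb{R}^n$. For $K,L\in\mathcal{S}^n_0$ and $i\in\mathbb{R}$, the $i$-th dual quermassintegral is $\widetilde{\mathrm{W}}_i(K,L)=\frac1n\int_{\mathbb{S}^{n-1}}\rho_K(u)^{n-i}\rho_L(u)^i\,d\sigma(u)$, where $\sigma$ is the usual spherical Lebesgue measure. For $0<a<b$, $C_{a,b}^I=\operatorname{pos}\{(1,t^{i_1},t^{i_2},\dots,t^{i_m}):t\in[a,b]\}\subset\mathbb{R}^{m+1}$, where $\operatorname{pos}$ denotes the positive hull (the set of all finite linear combinations with non-negative coefficients), and $\operatorname{int}$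 denotes the interior.
   Formalization: "In this case L = λK" is proved for every pair K, L attaining the values only when m ≥ 2 (for m ≤ 1 it is false, since the second alternative always holds while non-homothetic pairs exist); for all m, some attaining pair has L = λK. "Either ... or" is read inclusively. *)

theory Defs
  imports "HOL-Analysis.Analysis"
begin

definition radial_fun :: "'a::real_normed_vector set \<Rightarrow> 'a \<Rightarrow> real" where
  "radial_fun K u = (GREATEST l. 0 \<le> l \<and> l *\<^sub>R u \<in> K)"

definition star_body :: "'a::real_normed_vector set \<Rightarrow> bool" where
  "star_body K \<longleftrightarrow> K \<noteq> {} \<and> compact K \<and> (\<forall>x\<in>K. closed_segment 0 x \<subseteq> K) \<and>
     (\<forall>u\<in>sphere 0 1. 0 < radial_fun K u) \<and> continuous_on (sphere 0 1) (radial_fun K)"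

(* The spherical Lebesgue measure as the cone measure
   sigma(A) = n * vol {r u : 0 < r <= 1, u in A}; the lemma emeasure_sphere_measure
   below states this formula. *)
definition sphere_measure :: "'a::euclidean_space measure" where
  "sphere_measure = scale_measure (of_nat DIM('a))
     (distr (restrict_space lborel (cball 0 1 - {0})) (restrict_space borel (sphere 0 1))
       (\<lambda>x. x /\<^sub>R norm x))"

lemma space_sphere_measure: "space sphere_measure = sphere 0 1"
  by (simp add: sphere_measure_def space_scale_measure space_restrict_space)

lemma sets_sphere_measure: "sets sphere_measure = sets (restrict_space borel (sphere 0 1))"
  by (simp add: sphere_measure_def)

lemma emeasure_sphere_measure:
  fixes A :: "'a::euclidean_space set"
  assumes "A \<in> sets borel" "A \<subseteq> sphere 0 1"
  shows "emeasure sphere_measure A =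
    of_nat DIM('a) * emeasure lborel {r *\<^sub>R u | r u. 0 < r \<and> r \<le> 1 \<and> u \<in> A}"
proof -
  let ?B = "cball 0 1 - {0::'a}"
  have B: "?B \<in> sets borel" by auto
  have m: "(\<lambda>x. x /\<^sub>R norm x) \<in>
      measurable (restrict_space lborel ?B) (restrict_space borel (sphere 0 (1::real)))"
    by (rule measurable_restrict_space2)
       (auto simp: space_restrict_space intro!: measurable_restrict_space1)
  have A: "A \<in> sets (restrict_space borel (sphere 0 1))"
    using assms by (auto simp: sets_restrict_space)
  have eq: "(\<lambda>x. x /\<^sub>R norm x) -` A \<inter> ?B = {r *\<^sub>R u | r u. 0 < r \<and> r \<le> 1 \<and> u \<in> A}"
  proof (intro equalityI subsetI)
    fix x assume x: "x \<in> (\<lambda>x. x /\<^sub>R norm x) -` A \<inter> ?B"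
    then have "x = norm x *\<^sub>R (x /\<^sub>R norm x)" "0 < norm x" "norm x \<le> 1" by auto
    with x show "x \<in> {r *\<^sub>R u | r u. 0 < r \<and> r \<le> 1 \<and> u \<in> A}" by blast
  next
    fix x assume "x \<in> {r *\<^sub>R u | r u. 0 < r \<and> r \<le> 1 \<and> u \<in> A}"
    then obtain r u where x: "x = r *\<^sub>R u" and r: "0 < r" "r \<le> 1" and u: "u \<in> A" by blast
    have "norm u = 1" using u assms by auto
    then have "u \<noteq> 0" by auto
    with x r u \<open>norm u = 1\<close> show "x \<in> (\<lambda>x. x /\<^sub>R norm x) -` A \<inter> ?B" by auto
  qed
  show ?thesis
    unfolding sphere_measure_def
    using B by (simp add: emeasure_distr[OF m A] space_restrict_space emeasure_restrict_space eq[symmetric])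
qed

definition dual_quermass :: "real \<Rightarrow> 'a::euclidean_space set \<Rightarrow> 'a set \<Rightarrow> real" where
  "dual_quermass i K L = 1 / real DIM('a) *
     (LINT u|sphere_measure. radial_fun K u powr (real DIM('a) - i) * radial_fun L u powr i)"

definition pos_hull :: "'a::real_vector set \<Rightarrow> 'a set" where
  "pos_hull S = {\<Sum>x\<in>F. c x *\<^sub>R x | F c. finite F \<and> F \<subseteq> S \<and> (\<forall>x\<in>F. 0 \<le> c x)}"

(* The set I of m + 1 exponents is given by an injective family e on a finite type with
   m + 1 elements, which also indexes the coordinates of R^(m + 1). The exponent 0
   gives the coordinate 1, since t powr 0 = 1 for t > 0. *)
definition moment_cone :: "('k::finite \<Rightarrow> real) \<Rightarrow> real \<Rightarrow> real \<Rightarrow> (real ^ 'k) set" where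
  "moment_cone e a b = pos_hull ((\<lambda>t. \<chi> k. t powr e k) ` {a..b})"

end

theory Submission
  imports Defs
begin

text \<open>
  Put \<open>t = \<rho>\<^sub>L / \<rho>\<^sub>K\<close> and \<open>g = \<rho>\<^sub>K\<^sup>n / n\<close>. The dual quermassintegrals of \<open>K\<close> and \<open>L\<close> are then
  the moments \<open>\<integral> t\<^sup>i g d\<sigma>\<close>, and pairs of star bodies correspond exactly to pairs \<open>(t, g)\<close> of
  continuous positive functions on the sphere. The question thus becomes which vectors are moment
  vectors of some such pair. Pairing a moment vector \<open>w\<close> with a vector \<open>y\<close> gives
  \<open>y \<bullet> w = \<integral> f(t) g d\<sigma>\<close> with the generalized polynomial \<open>f(s) = \<Sum> y\<^sub>i s\<^sup>i\<close>, and everything rests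
  on the dual description of the interior of a convex cone (\<open>interior_convex_cone_iff\<close>):
  \<open>w\<close> is interior to the moment cone of \<open>[a, b]\<close> exactly when \<open>y \<bullet> w > 0\<close> for every nonzero \<open>y\<close>
  whose \<open>f\<close> is nonnegative on \<open>[a, b]\<close>.

  \<^bold>\<open>From bodies to the cone.\<close> The sphere is connected and compact, so the range of \<open>t\<close> is an interval
  \<open>[a, b]\<close>. If it is a point, the moments form a geometric sequence. Otherwise let \<open>f \<ge> 0\<close> on
  \<open>[a, b]\<close> and \<open>y \<bullet> w \<le> 0\<close>. Since \<open>\<sigma>\<close> charges every nonempty open set, \<open>f\<close> vanishes on the range of
  \<open>t\<close>; as powers with distinct exponents are linearly independent on an interval, \<open>y = 0\<close>
  (\<open>moments_in_interior_moment_cone\<close>).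

  \<^bold>\<open>From the cone to bodies.\<close> Fix any continuous \<open>t\<close> mapping the sphere onto \<open>[a, b]\<close>. The moment
  vectors of \<open>(t, g)\<close>, with \<open>g\<close> ranging over all continuous positive densities, form a convex cone.
  A functional \<open>y\<close> nonnegative on this cone has \<open>f(t) \<ge> 0\<close> on the sphere, so \<open>f \<ge> 0\<close> on \<open>[a, b]\<close>.
  By duality the interior of the moment cone lies inside the cone of moment vectors
  (\<open>density_with_moments\<close>).

  \<^bold>\<open>Uniqueness.\<close> For any three exponents and any \<open>\<lambda> > 0\<close> there is an \<open>f\<close> built from the three powers
  that is positive on \<open>(0, \<infinity>)\<close> except for a zero at \<open>\<lambda>\<close>. If the moments are \<open>\<lambda>\<^sup>i \<omega>\<^sub>0\<close>, then
  \<open>\<integral> f(t) g d\<sigma> = \<omega>\<^sub>0 f(\<lambda>) = 0\<close>, which forces \<open>t = \<lambda>\<close> everywhere, that is, \<open>L = \<lambda> K\<close>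
  (\<open>moments_determine_constant\<close>). With only two exponents no such \<open>f\<close> exists.
\<close>

section \<open>Real exponential sums\<close>

text \<open>Exponentials with distinct rates are linearly independent on every interval: after division
  by one of them, that term becomes constant, and differentiation leaves a relation with one term
  fewer, in which the coefficients are multiplied by nonzero differences of the rates.\<close>

lemma exp_sum_zero_imp_coeff_zero:
  fixes e y :: "'k \<Rightarrow> real"
  assumes "finite S" "inj_on e S" "c < d"
    and "\<And>x. c < x \<Longrightarrow> x < d \<Longrightarrow> (\<Sum>k\<in>S. y k * exp (e k * x)) = 0"
  shows "\<forall>k\<in>S. y k = 0"
  using assms(1,2,4)
proof (induction S arbitrary: y rule: finite_induct)
  case empty
  then show ?case by simp
next
  case (insert j S)
  \<comment> \<open>the relation divided by \<open>exp (e j * x)\<close>\<close>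
  define g where "g x = y j + (\<Sum>k\<in>S. y k * exp ((e k - e j) * x))" for x
  have g0: "g x = 0" if "c < x" "x < d" for x
  proof -
    have "exp (- (e j * x)) * (\<Sum>k\<in>insert j S. y k * exp (e k * x)) = g x"
      using insert.hyps
      by (simp add: g_def distrib_left sum_distrib_left left_diff_distrib exp_diff exp_minus
          field_simps)
    then show ?thesis using insert.prems(2)[OF that] by simp
  qed
  have "(\<Sum>k\<in>S. (y k * (e k - e j)) * exp (e k * x)) = 0" if x: "c < x" "x < d" for x
  proof -
    have "(g has_real_derivative (\<Sum>k\<in>S. y k * (exp ((e k - e j) * x) * (e k - e j)))) (at x)"
      unfolding g_def by (auto intro!: derivative_eq_intros sum.cong)
    moreover have "\<forall>z. \<bar>x - z\<bar> < min (x - c) (d - x) \<longrightarrow> g x = g z"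
      using x by (auto simp: g0 abs_if split: if_splits)
    ultimately have "(\<Sum>k\<in>S. y k * (exp ((e k - e j) * x) * (e k - e j))) = 0"
      using x by (intro DERIV_local_const[where d="min (x - c) (d - x)"]) auto
    then have "exp (e j * x) * (\<Sum>k\<in>S. y k * (exp ((e k - e j) * x) * (e k - e j))) = 0"
      by simp
    moreover have "exp (e j * x) * (y k * (exp ((e k - e j) * x) * (e k - e j))) =
        (y k * (e k - e j)) * exp (e k * x)" for k
    proof -
      have "exp ((e k - e j) * x) = exp (e k * x) / exp (e j * x)"
        by (simp add: left_diff_distrib exp_diff)
      then show ?thesis by simp
    qed
    ultimately show ?thesis by (simp add: sum_distrib_left)
  qed
  then have "\<forall>k\<in>S. y k * (e k - e j) = 0"
    using insert.prems(1) by (intro insert.IH) auto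
  moreover have "e k \<noteq> e j" if "k \<in> S" for k
    using insert that by (auto simp: inj_on_def)
  ultimately have S: "\<forall>k\<in>S. y k = 0" by auto
  moreover have "y j = 0"
    using g0[of "(c + d) / 2"] S \<open>c < d\<close> by (simp add: g_def)
  ultimately show ?case by simp
qed

lemma powr_sum_zero_imp_coeff_zero:
  fixes e y :: "'k::finite \<Rightarrow> real"
  assumes "inj e" "0 < a" "a < b"
    and "\<And>s. a \<le> s \<Longrightarrow> s \<le> b \<Longrightarrow> (\<Sum>k\<in>UNIV. y k * s powr e k) = 0"
  shows "y k = 0"
proof -
  have "\<forall>k\<in>UNIV. y k = 0"
  proof (rule exp_sum_zero_imp_coeff_zero[of UNIV e "ln a" "ln b"])
    fix x assume x: "ln a < x" "x < ln b"
    have "a \<le> exp x" "exp x \<le> b"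
      using x assms(2,3) by (metis exp_le_cancel_iff exp_ln less_le order.strict_trans)+
    from assms(4)[OF this] show "(\<Sum>k\<in>UNIV. y k * exp (e k * x)) = 0"
      by (simp add: powr_def)
  qed (use assms in auto)
  then show ?thesis by simp
qed

text \<open>After the substitution \<open>s = l exp x\<close> and division by \<open>exp (q x)\<close>, the sum is
  \<open>(r - q) exp (- (q - p) x) + (q - p) exp ((r - q) x) - (r - p)\<close>. The bound \<open>exp z \<ge> 1 + z\<close>,
  strict for \<open>z \<noteq> 0\<close>, shows that this is positive for \<open>x \<noteq> 0\<close>, since the weights are chosen such
  that the linear terms cancel.\<close>

lemma three_term_powr_sum:
  fixes p q r l :: real
  assumes "p < q" "q < r" "0 < l"
  obtains A B C where
    "A * l powr p + B * l powr q + C * l powr r = 0"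
    "\<And>s. 0 < s \<Longrightarrow> s \<noteq> l \<Longrightarrow> 0 < A * s powr p + B * s powr q + C * s powr r"
proof
  \<comment> \<open>weights that give value and derivative 0 at \<open>s = l\<close>\<close>
  define A where "A = (r - q) * l powr - p"
  define B where "B = - (r - p) * l powr - q"
  define C where "C = (q - p) * l powr - r"
  have scaled: "A * s powr p + B * s powr q + C * s powr r =
      exp (q * x) * ((r - q) * exp (- ((q - p) * x)) + (q - p) * exp ((r - q) * x) - (r - p))"
    if "0 < s" "x = ln s - ln l" for s x
  proof -
    have "l powr - c * s powr c = exp (c * x)" for c
      using that \<open>0 < l\<close> by (simp add: powr_def exp_add[symmetric] right_diff_distrib)
    then have *: "u * l powr - c * s powr c = u * exp (c * x)" for u c
      by (simp add: mult.assoc)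
    have "exp (q * x) * exp (- ((q - p) * x)) = exp (p * x)"
      and "exp (q * x) * exp ((r - q) * x) = exp (r * x)"
      by (simp_all add: exp_add[symmetric] algebra_simps)
    moreover have "E * ((r - q) * U + (q - p) * V - (r - p)) =
        (r - q) * (E * U) + - (r - p) * E + (q - p) * (E * V)" for E U V :: real
      by (simp add: algebra_simps)
    ultimately show ?thesis
      unfolding A_def B_def C_def * by simp
  qed
  show "A * l powr p + B * l powr q + C * l powr r = 0"
    using scaled[of l 0] \<open>0 < l\<close> by simp
  show "0 < A * s powr p + B * s powr q + C * s powr r" if "0 < s" "s \<noteq> l" for s
  proof -
    define x where "x = ln s - ln l"
    have "x \<noteq> 0" using that \<open>0 < l\<close> by (simp add: x_def)
    then have "1 - (q - p) * x < exp (- ((q - p) * x))"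
      using \<open>p < q\<close> by (simp add: exp_minus_greater)
    then have "(r - q) * (1 - (q - p) * x) < (r - q) * exp (- ((q - p) * x))"
      using \<open>q < r\<close> by (intro mult_strict_left_mono) auto
    moreover have "(q - p) * (1 + (r - q) * x) \<le> (q - p) * exp ((r - q) * x)"
      using \<open>p < q\<close> by (intro mult_left_mono exp_ge_add_one_self) auto
    ultimately have "0 < (r - q) * exp (- ((q - p) * x)) + (q - p) * exp ((r - q) * x) - (r - p)"
      by (simp add: algebra_simps)
    then show ?thesis unfolding scaled[OF \<open>0 < s\<close> x_def] by simp
  qed
qed

section \<open>Duality for convex cones\<close>

lemma convex_if_closed_add_scale:
  assumes "\<And>x y. x \<in> C \<Longrightarrow> y \<in> C \<Longrightarrow> x + y \<in> C"
    and "\<And>c x. 0 < c \<Longrightarrow> x \<in> C \<Longrightarrow> c *\<^sub>R x \<in> C"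
  shows "convex C"
proof (rule convexI)
  fix x y and u v :: real
  assume "x \<in> C" "y \<in> C" "0 \<le> u" "0 \<le> v" "u + v = 1"
  then show "u *\<^sub>R x + v *\<^sub>R y \<in> C"
    using assms by (cases "u = 0 \<or> v = 0") (auto simp: le_less)
qed

text \<open>Scaling a point of the cone towards 0 makes its value under \<open>y\<close> arbitrarily small, and
  scaling it up would make a negative value unbounded below.\<close>

lemma cone_lower_bound:
  assumes scale: "\<And>c x. 0 < c \<Longrightarrow> x \<in> C \<Longrightarrow> c *\<^sub>R x \<in> C"
    and bound: "\<And>x. x \<in> C \<Longrightarrow> b \<le> y \<bullet> x" and "x \<in> C"
  shows "b \<le> 0" "0 \<le> y \<bullet> x"
proof -
  have *: "b \<le> c * (y \<bullet> x)" if "0 < c" for c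
    using bound[OF scale[OF that \<open>x \<in> C\<close>]] by simp
  show "b \<le> 0"
  proof (rule ccontr)
    assume "\<not> b \<le> 0"
    moreover from this have "0 < y \<bullet> x" using *[of 1] by simp
    ultimately show False using *[of "b / (2 * (y \<bullet> x))"] by simp
  qed
  show "0 \<le> y \<bullet> x"
  proof (rule ccontr)
    assume neg: "\<not> 0 \<le> y \<bullet> x"
    \<comment> \<open>the scaling factor that sends a negative value to \<open>- (\<bar>b\<bar> + 1)\<close>, which is below \<open>b\<close>\<close>
    have "b \<le> ((\<bar>b\<bar> + 1) / - (y \<bullet> x)) * (y \<bullet> x)"
      using neg by (intro *) (auto simp: field_simps)
    also have "\<dots> = - (\<bar>b\<bar> + 1)" using neg by (simp add: field_simps)
    finally show False by simp
  qed
qed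

text \<open>If \<open>w\<close> is interior, then moving a little from \<open>w\<close> in the direction \<open>- y\<close> stays in the
  cone, so \<open>y \<bullet> w\<close> exceeds a nonnegative number. If \<open>w\<close> is not interior, some hyperplane
  separates it from \<open>C\<close>: one that contains \<open>C\<close> if \<open>C\<close> has empty interior, and otherwise one that
  separates \<open>w\<close> from the interior, whose closure contains \<open>C\<close>.\<close>

lemma interior_convex_cone_iff:
  fixes C :: "'a::euclidean_space set"
  assumes "C \<noteq> {}"
    and add: "\<And>x y. x \<in> C \<Longrightarrow> y \<in> C \<Longrightarrow> x + y \<in> C"
    and scale: "\<And>c x. 0 < c \<Longrightarrow> x \<in> C \<Longrightarrow> c *\<^sub>R x \<in> C"
  shows "w \<in> interior C \<longleftrightarrow> (\<forall>y. y \<noteq> 0 \<longrightarrow> (\<forall>x\<in>C. 0 \<le> y \<bullet> x) \<longrightarrow> 0 < y \<bullet> w)"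
proof (intro iffI allI impI)
  fix y assume w: "w \<in> interior C" and y: "y \<noteq> 0" "\<forall>x\<in>C. 0 \<le> y \<bullet> x"
  then obtain d where d: "0 < d" "cball w d \<subseteq> C"
    by (auto simp: mem_interior_cball)
  define x where "x = w - (d / norm y) *\<^sub>R y"
  have "x \<in> C" using d y by (auto simp: x_def dist_norm)
  then have "0 \<le> y \<bullet> w - d / norm y * (y \<bullet> y)"
    using y by (auto simp: x_def inner_diff_right)
  moreover have "0 < d / norm y * (y \<bullet> y)" using d y by simp
  ultimately show "0 < y \<bullet> w" by simp
next
  assume dual: "\<forall>y. y \<noteq> 0 \<longrightarrow> (\<forall>x\<in>C. 0 \<le> y \<bullet> x) \<longrightarrow> 0 < y \<bullet> w"
  have conv: "convex C" by (rule convex_if_closed_add_scale[OF add scale])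
  have "\<exists>y b. y \<noteq> 0 \<and> y \<bullet> w \<le> b \<and> (\<forall>x\<in>C. b \<le> y \<bullet> x)" if w: "w \<notin> interior C"
  proof (cases "interior C = {}")
    case True
    then obtain a b where ab: "a \<noteq> 0" "C \<subseteq> {x. a \<bullet> x = b}"
      using empty_interior_subset_hyperplane[OF conv] by blast
    show ?thesis
    proof (cases "a \<bullet> w \<le> b")
      case True
      then show ?thesis using ab by (intro exI[of _ a] exI[of _ b]) auto
    next
      case False
      \<comment> \<open>the cone lies in the hyperplane, so the normal may be reversed to put \<open>w\<close> on the right side\<close>
      then show ?thesis using ab by (intro exI[of _ "- a"] exI[of _ "- b"]) auto
    qed
  next
    case False
    then obtain a b where ab: "a \<noteq> 0" "a \<bullet> w \<le> b" "\<forall>x\<in>interior C. b \<le> a \<bullet> x"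
      using separating_hyperplane_sets[of "{w}" "interior C"] conv w by auto
    then have "closure (interior C) \<subseteq> {x. b \<le> a \<bullet> x}"
      by (intro closure_minimal) (auto simp: closed_halfspace_ge)
    then have "\<forall>x\<in>C. b \<le> a \<bullet> x"
      using convex_closure_interior[OF conv False] closure_subset by blast
    with ab show ?thesis by blast
  qed
  moreover have "w \<in> interior C"
    if y: "y \<noteq> 0" "y \<bullet> w \<le> b" "\<forall>x\<in>C. b \<le> y \<bullet> x" for y b
  proof -
    have "b \<le> 0" and "\<forall>x\<in>C. 0 \<le> y \<bullet> x"
      using cone_lower_bound[OF scale, of b y] y(3) \<open>C \<noteq> {}\<close> by blast+
    with dual y show ?thesis by fastforce
  qed
  ultimately show "w \<in> interior C" by blast
qed

lemma pos_hull_superset: "S \<subseteq> pos_hull S"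
proof
  fix x assume "x \<in> S"
  then show "x \<in> pos_hull S"
    unfolding pos_hull_def by (intro CollectI exI[of _ "{x}"] exI[of _ "\<lambda>_. 1"]) auto
qed

lemma pos_hull_scale:
  assumes "0 \<le> c" "x \<in> pos_hull S"
  shows "c *\<^sub>R x \<in> pos_hull S"
proof -
  obtain F d where "x = (\<Sum>z\<in>F. d z *\<^sub>R z)" "finite F" "F \<subseteq> S" "\<forall>z\<in>F. 0 \<le> d z"
    using assms(2) by (auto simp: pos_hull_def)
  then show ?thesis
    unfolding pos_hull_def using assms(1)
    by (intro CollectI exI[of _ F] exI[of _ "\<lambda>z. c * d z"]) (auto simp: scaleR_sum_right)
qed

lemma pos_hull_add:
  assumes "x \<in> pos_hull S" "y \<in> pos_hull S"
  shows "x + y \<in> pos_hull S"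
proof -
  obtain F c where F: "x = (\<Sum>z\<in>F. c z *\<^sub>R z)" "finite F" "F \<subseteq> S" "\<forall>z\<in>F. 0 \<le> c z"
    using assms(1) by (auto simp: pos_hull_def)
  obtain G d where G: "y = (\<Sum>z\<in>G. d z *\<^sub>R z)" "finite G" "G \<subseteq> S" "\<forall>z\<in>G. 0 \<le> d z"
    using assms(2) by (auto simp: pos_hull_def)
  let ?h = "\<lambda>z. (if z \<in> F then c z else 0) + (if z \<in> G then d z else 0)"
  have "x = (\<Sum>z\<in>F \<union> G. (if z \<in> F then c z else 0) *\<^sub>R z)"
    unfolding F(1) using F G by (intro sum.mono_neutral_cong_left) auto
  moreover have "y = (\<Sum>z\<in>F \<union> G. (if z \<in> G then d z else 0) *\<^sub>R z)"
    unfolding G(1) using F G by (intro sum.mono_neutral_cong_left) auto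
  ultimately have "x + y = (\<Sum>z\<in>F \<union> G. ?h z *\<^sub>R z)"
    by (simp add: scaleR_add_left sum.distrib)
  then show ?thesis
    unfolding pos_hull_def using F G
    by (intro CollectI exI[of _ "F \<union> G"] exI[of _ ?h]) auto
qed

lemma inner_nonneg_pos_hull_iff:
  "(\<forall>x\<in>pos_hull S. 0 \<le> y \<bullet> x) \<longleftrightarrow> (\<forall>x\<in>S. 0 \<le> y \<bullet> x)"
proof
  show "\<forall>x\<in>pos_hull S. 0 \<le> y \<bullet> x \<Longrightarrow> \<forall>x\<in>S. 0 \<le> y \<bullet> x"
    using pos_hull_superset by blast
  show "\<forall>x\<in>pos_hull S. 0 \<le> y \<bullet> x" if "\<forall>x\<in>S. 0 \<le> y \<bullet> x"
    using that unfolding pos_hull_def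
    by (auto simp: inner_sum_right subset_iff intro!: sum_nonneg mult_nonneg_nonneg)
qed

lemma interior_moment_cone_iff:
  fixes e :: "'k::finite \<Rightarrow> real"
  assumes "a \<le> b"
  shows "w \<in> interior (moment_cone e a b) \<longleftrightarrow>
    (\<forall>y. y \<noteq> 0 \<longrightarrow> (\<forall>s. a \<le> s \<longrightarrow> s \<le> b \<longrightarrow> 0 \<le> (\<Sum>k\<in>UNIV. y $ k * s powr e k)) \<longrightarrow>
      0 < y \<bullet> w)"
proof -
  let ?S = "(\<lambda>s. \<chi> k. s powr e k) ` {a..b}"
  have "w \<in> interior (pos_hull ?S) \<longleftrightarrow>
      (\<forall>y. y \<noteq> 0 \<longrightarrow> (\<forall>x\<in>pos_hull ?S. 0 \<le> y \<bullet> x) \<longrightarrow> 0 < y \<bullet> w)"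
    using assms pos_hull_superset[of ?S]
    by (intro interior_convex_cone_iff pos_hull_add pos_hull_scale) auto
  moreover have "(\<forall>x\<in>?S. 0 \<le> y \<bullet> x) \<longleftrightarrow>
      (\<forall>s. a \<le> s \<longrightarrow> s \<le> b \<longrightarrow> 0 \<le> (\<Sum>k\<in>UNIV. y $ k * s powr e k))" for y
    by (auto simp: inner_vec_def)
  ultimately show ?thesis
    unfolding inner_nonneg_pos_hull_iff moment_cone_def by simp
qed

section \<open>Integration of continuous functions on the sphere\<close>

lemma finite_measure_sphere_measure:
  "finite_measure (sphere_measure :: 'a::euclidean_space measure)"
proof
  let ?C = "{r *\<^sub>R u | r u. 0 < r \<and> r \<le> 1 \<and> u \<in> sphere (0::'a) 1}"
  have "emeasure lborel ?C \<le> emeasure lborel (cball (0::'a) 1)"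
    by (intro emeasure_mono) auto
  also have "\<dots> < \<infinity>" by (rule emeasure_lborel_cball_finite)
  finally have "emeasure sphere_measure (sphere (0::'a) 1) \<noteq> \<infinity>"
    by (subst emeasure_sphere_measure) (auto simp: ennreal_mult_eq_top_iff)
  then show "emeasure sphere_measure (space (sphere_measure :: 'a measure)) \<noteq> \<infinity>"
    by (simp add: space_sphere_measure)
qed

lemma borel_measurable_sphere_measure:
  fixes f :: "'a::euclidean_space \<Rightarrow> real"
  assumes "continuous_on (sphere 0 1) f"
  shows "f \<in> borel_measurable sphere_measure"
  using borel_measurable_continuous_on_restrict[OF assms]
  by (simp cong: measurable_cong_sets add: sets_sphere_measure)

lemma integrable_sphere_measure:
  fixes f :: "'a::euclidean_space \<Rightarrow> real"
  assumes "continuous_on (sphere 0 1) f"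
  shows "integrable sphere_measure f"
proof -
  interpret finite_measure "sphere_measure :: 'a measure"
    by (rule finite_measure_sphere_measure)
  have "bounded (f ` sphere 0 1)"
    using assms by (intro compact_imp_bounded compact_continuous_image) auto
  then obtain B where "\<forall>u\<in>sphere 0 1. norm (f u) \<le> B"
    by (auto simp: bounded_iff)
  then show ?thesis
    using assms
    by (intro integrable_const_bound[of _ B] borel_measurable_sphere_measure AE_I2)
       (auto simp: space_sphere_measure)
qed

text \<open>The measure of \<open>sphere 0 1 \<inter> U\<close> is proportional to the volume of the solid cone over it,
  which contains a nonempty open set.\<close>

lemma emeasure_sphere_measure_open_pos:
  fixes U :: "'a::euclidean_space set"
  assumes "open U" "u \<in> U" "u \<in> sphere 0 1"
  shows "emeasure sphere_measure (sphere 0 1 \<inter> U) \<noteq> 0"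
proof -
  let ?V = "{x \<in> - {0}. x /\<^sub>R norm x \<in> U}"
  let ?C = "{r *\<^sub>R v | r v. 0 < r \<and> r \<le> 1 \<and> v \<in> sphere 0 1 \<inter> U}"
  have V: "open ?V"
  proof -
    have "continuous_on (- {0}) (\<lambda>x::'a. x /\<^sub>R norm x)"
      by (intro continuous_intros) auto
    then have "open (- {0} \<inter> (\<lambda>x. x /\<^sub>R norm x) -` U)"
      using \<open>open U\<close> by (intro continuous_open_preimage) auto
    then show ?thesis by (simp add: vimage_def Int_def)
  qed
  have C: "?C = cball 0 1 \<inter> ?V"
  proof (intro equalityI subsetI)
    fix x assume "x \<in> ?C"
    then show "x \<in> cball 0 1 \<inter> ?V" by auto
  next
    fix x assume "x \<in> cball 0 1 \<inter> ?V"
    then have "x = norm x *\<^sub>R (x /\<^sub>R norm x)" "0 < norm x" "norm x \<le> 1"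
      "x /\<^sub>R norm x \<in> sphere 0 1 \<inter> U"
      by auto
    then show "x \<in> ?C" by blast
  qed
  have "\<not> negligible (ball 0 1 \<inter> ?V)"
  proof (rule open_not_negligible)
    have "u /\<^sub>R 2 \<in> ball 0 1 \<inter> ?V" using assms by auto
    then show "ball 0 1 \<inter> ?V \<noteq> {}" by blast
  qed (use V in auto)
  then have "\<not> negligible ?C"
    unfolding C by (rule contrapos_nn) (auto elim!: negligible_subset)
  moreover have "?C \<in> sets borel"
    unfolding C using V by auto
  ultimately have "emeasure lborel ?C \<noteq> 0"
    by (auto simp: negligible_iff_null_sets null_sets_def)
  moreover have "emeasure sphere_measure (sphere 0 1 \<inter> U) = of_nat DIM('a) * emeasure lborel ?C"
    using \<open>open U\<close> by (intro emeasure_sphere_measure) auto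
  ultimately show ?thesis by simp
qed

text \<open>Almost everywhere vanishing of a continuous function is vanishing everywhere, because
  nonempty open subsets of the sphere have positive measure.\<close>

lemma sphere_integral_zero_imp_zero:
  fixes f :: "'a::euclidean_space \<Rightarrow> real"
  assumes cont: "continuous_on (sphere 0 1) f"
    and nonneg: "\<And>u. u \<in> sphere 0 1 \<Longrightarrow> 0 \<le> f u"
    and le: "(LINT u|sphere_measure. f u) \<le> 0"
    and u: "u \<in> sphere 0 1"
  shows "f u = 0"
proof (rule ccontr)
  assume "f u \<noteq> 0"
  have "openin (top_of_set (sphere 0 1)) (sphere 0 1 \<inter> f -` (- {0}))"
    using cont by (intro continuous_openin_preimage_gen) auto
  then obtain U where U: "open U" "sphere 0 1 \<inter> f -` (- {0}) = sphere 0 1 \<inter> U"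
    by (auto simp: openin_open)
  have AE_nonneg: "AE u in sphere_measure. 0 \<le> f u"
    using nonneg by (intro AE_I2) (simp add: space_sphere_measure)
  then have "(LINT u|sphere_measure. f u) = 0"
    using le by (intro antisym integral_nonneg_AE)
  then have AE_zero: "AE u in sphere_measure. f u = 0"
    using integral_nonneg_eq_0_iff_AE[OF integrable_sphere_measure[OF cont] AE_nonneg] by blast
  have eq: "{u \<in> space sphere_measure. \<not> f u = 0} = sphere 0 1 \<inter> U"
    unfolding U(2)[symmetric] by (auto simp: space_sphere_measure)
  have sets: "sphere 0 1 \<inter> U \<in> sets sphere_measure"
    using U(1) by (auto simp: sets_sphere_measure sets_restrict_space)
  have "emeasure sphere_measure (sphere 0 1 \<inter> U) = 0"
    using AE_iff_measurable[OF sets eq] AE_zero by blast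
  moreover have "u \<in> sphere 0 1 \<inter> f -` (- {0})" using u \<open>f u \<noteq> 0\<close> by simp
  then have "u \<in> U" unfolding U(2) by simp
  ultimately show False
    using emeasure_sphere_measure_open_pos[OF U(1) _ u] by blast
qed

text \<open>Testing with \<open>g = h\<^sup>- + c\<close>, where \<open>h\<^sup>-\<close> is the negative part of \<open>h\<close> and \<open>c > 0\<close> makes the test
  function positive, gives \<open>\<integral> (h\<^sup>-)\<^sup>2 \<le> c \<integral> h\<close>. Letting \<open>c\<close> tend to 0 shows \<open>h\<^sup>- = 0\<close>.\<close>

lemma nonneg_if_sphere_integrals_nonneg:
  fixes h :: "'a::euclidean_space \<Rightarrow> real"
  assumes cont: "continuous_on (sphere 0 1) h"
    and test: "\<And>g. continuous_on (sphere 0 1) g \<Longrightarrow> (\<And>u. u \<in> sphere 0 1 \<Longrightarrow> 0 < g u) \<Longrightarrow>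
      0 \<le> (LINT u|sphere_measure. h u * g u)"
    and u: "u \<in> sphere 0 1"
  shows "0 \<le> h u"
proof -
  define m where "m u = max 0 (- h u)" for u
  have m: "continuous_on (sphere 0 1) m"
    unfolding m_def using cont by (intro continuous_intros)
  have bound: "(LINT u|sphere_measure. (m u)\<^sup>2) \<le> c * (LINT u|sphere_measure. h u)"
    if "0 < c" for c
  proof -
    have "0 \<le> (LINT u|sphere_measure. h u * (m u + c))"
      using m that by (intro test continuous_intros) (auto simp: m_def)
    also have "\<dots> = (LINT u|sphere_measure. c * h u - (m u)\<^sup>2)"
      by (intro Bochner_Integration.integral_cong)
         (auto simp: m_def max_def algebra_simps power2_eq_square)
    also have "\<dots> = c * (LINT u|sphere_measure. h u) - (LINT u|sphere_measure. (m u)\<^sup>2)"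
      using cont m
      by (subst Bochner_Integration.integral_diff)
         (auto intro!: integrable_sphere_measure continuous_intros)
    finally show ?thesis by simp
  qed
  have "(LINT u|sphere_measure. (m u)\<^sup>2) \<le> 0"
  proof (rule field_le_epsilon)
    fix \<epsilon> :: real assume "0 < \<epsilon>"
    define H where "H = (LINT u|sphere_measure. h u)"
    \<comment> \<open>the summand 1 keeps the denominator positive also when \<open>H = 0\<close>\<close>
    have "(LINT u|sphere_measure. (m u)\<^sup>2) \<le> \<epsilon> / (\<bar>H\<bar> + 1) * H"
      unfolding H_def using \<open>0 < \<epsilon>\<close> by (intro bound) auto
    also have "\<dots> \<le> \<epsilon> / (\<bar>H\<bar> + 1) * (\<bar>H\<bar> + 1)"
      using \<open>0 < \<epsilon>\<close> by (intro mult_left_mono) auto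
    also have "\<dots> = 0 + \<epsilon>" by simp
    finally show "(LINT u|sphere_measure. (m u)\<^sup>2) \<le> 0 + \<epsilon>" .
  qed
  then have "(m u)\<^sup>2 = 0"
    using m u by (intro sphere_integral_zero_imp_zero[of "\<lambda>u. (m u)\<^sup>2"] continuous_intros) auto
  then show ?thesis by (simp add: m_def)
qed

section \<open>Star bodies and their radial functions\<close>

text \<open>The body is an image of a compact set, which makes its compactness immediate; the factor
  \<open>r = 0\<close> supplies the origin.\<close>

definition star_with_radius :: "('a::real_normed_vector \<Rightarrow> real) \<Rightarrow> 'a set" where
  "star_with_radius p = (\<lambda>(r, u). (r * p u) *\<^sub>R u) ` ({0..1} \<times> sphere 0 1)"

lemma scaleR_mem_star_with_radius_iff:
  assumes p: "\<And>v. v \<in> sphere 0 1 \<Longrightarrow> 0 < p v" and u: "u \<in> sphere 0 1" and "0 \<le> l"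
  shows "l *\<^sub>R u \<in> star_with_radius p \<longleftrightarrow> l \<le> p u"
proof
  assume "l *\<^sub>R u \<in> star_with_radius p"
  then obtain r v where rv: "0 \<le> r" "r \<le> 1" "v \<in> sphere 0 1" "l *\<^sub>R u = (r * p v) *\<^sub>R v"
    by (auto simp: star_with_radius_def)
  have "norm (l *\<^sub>R u) = l" using u \<open>0 \<le> l\<close> by simp
  moreover have "norm ((r * p v) *\<^sub>R v) = r * p v"
    using rv(1,3) p[OF rv(3)] by (simp add: abs_mult)
  ultimately have l: "l = r * p v" using rv(4) by simp
  show "l \<le> p u"
  proof (cases "l = 0")
    case False
    with rv(4) l have "u = v" by simp
    with l rv p[OF u] show ?thesis by (simp add: mult_left_le_one_le)
  qed (use p[OF u] in simp)
next
  assume "l \<le> p u"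
  with p[OF u] u \<open>0 \<le> l\<close> show "l *\<^sub>R u \<in> star_with_radius p"
    unfolding star_with_radius_def by (intro image_eqI[of _ _ "(l / p u, u)"]) auto
qed

lemma radial_fun_star_with_radius:
  assumes "\<And>v. v \<in> sphere 0 1 \<Longrightarrow> 0 < p v" and "u \<in> sphere 0 1"
  shows "radial_fun (star_with_radius p) u = p u"
  unfolding radial_fun_def
  using scaleR_mem_star_with_radius_iff[of p, OF assms] assms
  by (intro Greatest_equality) (auto simp: less_imp_le)

lemma star_body_star_with_radius:
  fixes p :: "'a::euclidean_space \<Rightarrow> real"
  assumes cont: "continuous_on (sphere 0 1) p" and pos: "\<And>v. v \<in> sphere 0 1 \<Longrightarrow> 0 < p v"
  shows "star_body (star_with_radius p)"
  unfolding star_body_def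
proof (intro conjI ballI)
  obtain b :: 'a where "b \<in> Basis" using nonempty_Basis by blast
  then have "(0::real, b) \<in> {0..1} \<times> sphere 0 1" by auto
  then show "star_with_radius p \<noteq> {}" by (auto simp: star_with_radius_def)
  have "continuous_on ({0..1} \<times> sphere 0 1) (\<lambda>x::real \<times> 'a. p (snd x))"
    by (rule continuous_on_compose2[OF cont]) (auto intro: continuous_intros)
  then show "compact (star_with_radius p)"
    unfolding star_with_radius_def
    by (intro compact_continuous_image compact_Times)
       (auto simp: case_prod_unfold intro!: continuous_intros)
  fix x assume "x \<in> star_with_radius p"
  then obtain r u where ru: "0 \<le> r" "r \<le> 1" "u \<in> sphere 0 1" "x = (r * p u) *\<^sub>R u"
    by (auto simp: star_with_radius_def)
  show "closed_segment 0 x \<subseteq> star_with_radius p"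
  proof
    fix z assume "z \<in> closed_segment 0 x"
    then obtain c where c: "0 \<le> c" "c \<le> 1" "z = c *\<^sub>R x"
      by (auto simp: closed_segment_def)
    with ru show "z \<in> star_with_radius p"
      unfolding star_with_radius_def
      by (intro image_eqI[of _ _ "(c * r, u)"]) (auto simp: mult_le_one)
  qed
next
  show "0 < radial_fun (star_with_radius p) u" if "u \<in> sphere 0 1" for u
    using that by (simp only: radial_fun_star_with_radius[of p, OF pos] pos)
  show "continuous_on (sphere 0 1) (radial_fun (star_with_radius p))"
    using cont by (subst continuous_on_cong[OF refl radial_fun_star_with_radius[of p, OF pos]])
qed

text \<open>The set of admissible multiples of \<open>u\<close> is compact and nonempty, so the maximum in the
  definition of the radial function is attained, and all smaller multiples belong to the body
  because it is starshaped.\<close>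

lemma star_body_scaleR_mem_iff:
  fixes K :: "'a::real_normed_vector set"
  assumes K: "star_body K" and u: "u \<in> sphere 0 1" and "0 \<le> l"
  shows "l *\<^sub>R u \<in> K \<longleftrightarrow> l \<le> radial_fun K u"
proof -
  let ?R = "{l. 0 \<le> l \<and> l *\<^sub>R u \<in> K}"
  have seg: "c *\<^sub>R x \<in> K" if "x \<in> K" "0 \<le> c" "c \<le> 1" for c x
  proof -
    have "c *\<^sub>R x \<in> closed_segment 0 x"
      unfolding closed_segment_def using that by (intro CollectI exI[of _ c]) simp
    then show ?thesis using K \<open>x \<in> K\<close> by (auto simp: star_body_def)
  qed
  obtain x where "x \<in> K" using K by (auto simp: star_body_def)
  then have ne: "?R \<noteq> {}" using seg[of x 0] by (auto intro!: exI[of _ 0])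
  obtain B where B: "\<And>x. x \<in> K \<Longrightarrow> norm x \<le> B"
    using K compact_imp_bounded[of K] by (auto simp: star_body_def bounded_iff)
  have bdd: "?R \<subseteq> {0..B}"
  proof
    fix l assume "l \<in> ?R"
    then show "l \<in> {0..B}" using B[of "l *\<^sub>R u"] u by simp
  qed
  have "closed ?R"
  proof -
    have "closed ({0..} \<inter> (\<lambda>l. l *\<^sub>R u) -` K)"
      using K by (intro closed_Int closed_vimage)
        (auto simp: star_body_def compact_imp_closed intro!: continuous_intros)
    then show ?thesis by (simp add: vimage_def Int_def)
  qed
  then have "compact ?R"
    using bounded_subset[OF _ bdd] by (auto simp: compact_eq_bounded_closed)
  then obtain m where m: "m \<in> ?R" "\<And>l. l \<in> ?R \<Longrightarrow> l \<le> m"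
    using compact_attains_sup[OF _ ne] by blast
  then have rad: "radial_fun K u = m"
    unfolding radial_fun_def by (intro Greatest_equality) auto
  show ?thesis
  proof
    show "l *\<^sub>R u \<in> K \<Longrightarrow> l \<le> radial_fun K u" using m rad \<open>0 \<le> l\<close> by auto
    assume "l \<le> radial_fun K u"
    show "l *\<^sub>R u \<in> K"
    proof (cases "m = 0")
      case True
      with rad m \<open>0 \<le> l\<close> \<open>l \<le> radial_fun K u\<close> show ?thesis by auto
    next
      case False
      with m rad \<open>0 \<le> l\<close> \<open>l \<le> radial_fun K u\<close> seg[of "m *\<^sub>R u" "l / m"] show ?thesis by auto
    qed
  qed
qed

lemma star_body_eq_star_with_radius:
  fixes K :: "'a::euclidean_space set"
  assumes K: "star_body K"
  shows "K = star_with_radius (radial_fun K)"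
proof -
  have pos: "\<And>u. u \<in> sphere 0 1 \<Longrightarrow> 0 < radial_fun K u"
    using K by (auto simp: star_body_def)
  obtain b :: 'a where "b \<in> Basis" using nonempty_Basis by blast
  have "x \<in> K \<longleftrightarrow> x \<in> star_with_radius (radial_fun K)" for x
  proof -
    \<comment> \<open>the origin lies on every ray, so an arbitrary direction serves for it\<close>
    define u where "u = (if x = 0 then b else x /\<^sub>R norm x)"
    have "u \<in> sphere 0 1" "x = norm x *\<^sub>R u"
      using \<open>b \<in> Basis\<close> by (auto simp: u_def)
    then show ?thesis
      using star_body_scaleR_mem_iff[OF K, of u "norm x"]
        scaleR_mem_star_with_radius_iff[of "radial_fun K", OF pos, of u "norm x"]
      by auto
  qed
  then show ?thesis by blast
qed

lemma star_with_radius_cmult: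
  fixes p q :: "'a::real_normed_vector \<Rightarrow> real"
  assumes "\<And>u. u \<in> sphere 0 1 \<Longrightarrow> q u = l * p u"
  shows "star_with_radius q = (\<lambda>x. l *\<^sub>R x) ` star_with_radius p"
  unfolding star_with_radius_def image_image
proof (intro image_cong refl)
  fix x :: "real \<times> 'a" assume "x \<in> {0..1} \<times> sphere 0 1"
  then obtain r u where "x = (r, u)" "q u = l * p u" using assms by blast
  then show "(case x of (r, u) \<Rightarrow> (r * q u) *\<^sub>R u) =
      l *\<^sub>R (case x of (r, u) \<Rightarrow> (r * p u) *\<^sub>R u)"
    by (simp add: mult.left_commute)
qed

section \<open>Dual quermassintegrals as moments\<close>

lemma powr_split_quotient:
  fixes p q c i :: real
  assumes "0 < p" "0 < q"
  shows "p powr (c - i) * q powr i = p powr c * (q / p) powr i"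
  using assms by (simp add: powr_diff powr_divide)

lemma dual_quermass_eq_moment:
  fixes K L :: "'a::euclidean_space set"
  assumes "star_body K" "star_body L"
  shows "dual_quermass i K L = (LINT u|sphere_measure.
    (radial_fun L u / radial_fun K u) powr i * (radial_fun K u powr DIM('a) / DIM('a)))"
proof -
  have "(LINT u|sphere_measure. radial_fun K u powr (real DIM('a) - i) * radial_fun L u powr i) =
    (LINT u|sphere_measure. real DIM('a) *
      ((radial_fun L u / radial_fun K u) powr i * (radial_fun K u powr DIM('a) / DIM('a))))"
    using assms by (intro Bochner_Integration.integral_cong refl)
      (auto simp: space_sphere_measure star_body_def powr_split_quotient)
  then show ?thesis by (simp add: dual_quermass_def)
qed

text \<open>The radius of \<open>K\<close> is dictated by \<open>\<rho>\<^sub>K\<^sup>n / n = g\<close> and that of \<open>L\<close> by \<open>\<rho>\<^sub>L = t \<rho>\<^sub>K\<close>.\<close>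

lemma star_bodies_with_moments:
  fixes t g :: "'a::euclidean_space \<Rightarrow> real"
  assumes t: "continuous_on (sphere 0 1) t" "\<And>u. u \<in> sphere 0 1 \<Longrightarrow> 0 < t u"
    and g: "continuous_on (sphere 0 1) g" "\<And>u. u \<in> sphere 0 1 \<Longrightarrow> 0 < g u"
  obtains p where "star_body (star_with_radius p)" "star_body (star_with_radius (\<lambda>u. t u * p u))"
    "\<And>i. dual_quermass i (star_with_radius p) (star_with_radius (\<lambda>u. t u * p u)) =
      (LINT u|sphere_measure. t u powr i * g u)"
proof
  define p where "p u = (DIM('a) * g u) powr (1 / DIM('a))" for u
  have cp: "continuous_on (sphere 0 1) p"
    unfolding p_def using g by (intro continuous_intros) (auto simp: less_imp_neq[symmetric])
  have pp: "0 < p u" if "u \<in> sphere 0 1" for u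
    using g(2)[OF that] by (auto simp: p_def)
  show K: "star_body (star_with_radius p)"
    by (rule star_body_star_with_radius[OF cp pp])
  have tp: "0 < t u * p u" if "u \<in> sphere 0 1" for u
    using t(2) pp that by simp
  show L: "star_body (star_with_radius (\<lambda>u. t u * p u))"
    using t(1) cp tp by (intro star_body_star_with_radius continuous_intros)
  show "dual_quermass i (star_with_radius p) (star_with_radius (\<lambda>u. t u * p u)) =
      (LINT u|sphere_measure. t u powr i * g u)" for i
    unfolding dual_quermass_eq_moment[OF K L]
  proof (intro Bochner_Integration.integral_cong refl)
    fix u assume "u \<in> space (sphere_measure :: 'a measure)"
    then have u: "u \<in> sphere 0 1" by (simp add: space_sphere_measure)
    have "p u powr DIM('a) = DIM('a) * g u"
      using g(2)[OF u] by (simp add: p_def powr_powr)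
    moreover have "radial_fun (star_with_radius p) u = p u"
      using pp u by (rule radial_fun_star_with_radius)
    moreover have "radial_fun (star_with_radius (\<lambda>u. t u * p u)) u = t u * p u"
      using tp u by (rule radial_fun_star_with_radius)
    ultimately show "(radial_fun (star_with_radius (\<lambda>u. t u * p u)) u /
          radial_fun (star_with_radius p) u) powr i *
        (radial_fun (star_with_radius p) u powr DIM('a) / DIM('a)) = t u powr i * g u"
      using pp[OF u] by simp
  qed
qed

lemma inner_moment_vector:
  fixes e :: "'k::finite \<Rightarrow> real" and t g :: "'a::euclidean_space \<Rightarrow> real"
  assumes t: "continuous_on (sphere 0 1) t" "\<And>u. u \<in> sphere 0 1 \<Longrightarrow> 0 < t u"
    and g: "continuous_on (sphere 0 1) g"
    and w: "\<And>k. w $ k = (LINT u|sphere_measure. t u powr e k * g u)"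
  shows "y \<bullet> w = (LINT u|sphere_measure. (\<Sum>k\<in>UNIV. y $ k * t u powr e k) * g u)"
proof -
  have int: "integrable sphere_measure (\<lambda>u. t u powr e k * g u)" for k
    using t g by (intro integrable_sphere_measure continuous_intros)
      (auto simp: less_imp_neq[symmetric])
  have "y \<bullet> w = (\<Sum>k\<in>UNIV. LINT u|sphere_measure. y $ k * (t u powr e k * g u))"
    by (simp add: inner_vec_def w)
  also have "\<dots> = (LINT u|sphere_measure. (\<Sum>k\<in>UNIV. y $ k * (t u powr e k * g u)))"
    using int by (intro Bochner_Integration.integral_sum[symmetric]) auto
  finally show ?thesis by (simp add: sum_distrib_right mult.assoc)
qed

lemma continuous_on_powr_sum:
  fixes t :: "'a::topological_space \<Rightarrow> real"
  assumes "continuous_on S t" "\<And>u. u \<in> S \<Longrightarrow> 0 < t u"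
  shows "continuous_on S (\<lambda>u. \<Sum>k\<in>A. y k * t u powr e k)"
  using assms by (intro continuous_intros) (auto simp: less_imp_neq[symmetric])

text \<open>This is the equality case of the pairing between moment vectors and nonnegative
  generalized polynomials: the integrand \<open>f(t) g\<close> is nonnegative and continuous, so it can only
  have integral at most 0 if \<open>f\<close> vanishes at every value of \<open>t\<close>.\<close>

lemma powr_sum_zero_on_range_if_moment_le_zero:
  fixes e :: "'k::finite \<Rightarrow> real" and t g :: "'a::euclidean_space \<Rightarrow> real"
  assumes t: "continuous_on (sphere 0 1) t" "\<And>u. u \<in> sphere 0 1 \<Longrightarrow> 0 < t u"
    and g: "continuous_on (sphere 0 1) g" "\<And>u. u \<in> sphere 0 1 \<Longrightarrow> 0 < g u"
    and w: "\<And>k. w $ k = (LINT u|sphere_measure. t u powr e k * g u)"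
    and nonneg: "\<And>u. u \<in> sphere 0 1 \<Longrightarrow> 0 \<le> (\<Sum>k\<in>UNIV. y $ k * t u powr e k)"
    and le: "y \<bullet> w \<le> 0" and u: "u \<in> sphere 0 1"
  shows "(\<Sum>k\<in>UNIV. y $ k * t u powr e k) = 0"
proof -
  let ?f = "\<lambda>u. (\<Sum>k\<in>UNIV. y $ k * t u powr e k) * g u"
  have "continuous_on (sphere 0 1) ?f"
    using continuous_on_powr_sum[OF t] g(1) by (rule continuous_on_mult)
  moreover have "0 \<le> ?f u" if "u \<in> sphere 0 1" for u
    using nonneg[OF that] g(2)[OF that] by simp
  moreover have "(LINT u|sphere_measure. ?f u) \<le> 0"
    using inner_moment_vector[OF t g(1) w] le by simp
  ultimately have "?f u = 0"
    by (rule sphere_integral_zero_imp_zero[OF _ _ _ u])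
  then show ?thesis using g(2)[OF u] by simp
qed

text \<open>By the dual description of the interior, it suffices to exclude a nonzero \<open>y\<close> with \<open>f \<ge> 0\<close>
  on \<open>[a, b]\<close> and \<open>y \<bullet> w \<le> 0\<close>. Then \<open>f\<close> would vanish on the range of \<open>t\<close>, which is all of
  \<open>[a, b]\<close>, against linear independence of the powers.\<close>

lemma moments_in_interior_moment_cone:
  fixes e :: "'k::finite \<Rightarrow> real" and t g :: "'a::euclidean_space \<Rightarrow> real"
  assumes "inj e" "0 < a" "a < b"
    and t: "continuous_on (sphere 0 1) t" "t ` sphere 0 1 = {a..b}"
    and g: "continuous_on (sphere 0 1) g" "\<And>u. u \<in> sphere 0 1 \<Longrightarrow> 0 < g u"
    and w: "\<And>k. w $ k = (LINT u|sphere_measure. t u powr e k * g u)"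
  shows "w \<in> interior (moment_cone e a b)"
  unfolding interior_moment_cone_iff[OF less_imp_le[OF \<open>a < b\<close>]]
proof (intro allI impI)
  fix y :: "real ^ 'k"
  let ?f = "\<lambda>s. \<Sum>k\<in>UNIV. y $ k * s powr e k"
  assume "y \<noteq> 0" and nonneg: "\<forall>s. a \<le> s \<longrightarrow> s \<le> b \<longrightarrow> 0 \<le> ?f s"
  have tab: "a \<le> t u" "t u \<le> b" if "u \<in> sphere 0 1" for u
    using t(2) that by (metis atLeastAtMost_iff imageI)+
  have tpos: "0 < t u" if "u \<in> sphere 0 1" for u
    using tab[OF that] \<open>0 < a\<close> by simp
  show "0 < y \<bullet> w"
  proof (rule ccontr)
    assume "\<not> 0 < y \<bullet> w"
    then have f0: "?f (t u) = 0" if "u \<in> sphere 0 1" for u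
      using powr_sum_zero_on_range_if_moment_le_zero[OF t(1) tpos g w _ _ that] nonneg tab
      by auto
    have "?f s = 0" if "a \<le> s" "s \<le> b" for s
    proof -
      have "s \<in> t ` sphere 0 1" using that by (simp add: t(2))
      then obtain u where "u \<in> sphere 0 1" "s = t u" by blast
      then show ?thesis using f0 by simp
    qed
    then have "y $ k = 0" for k
      using powr_sum_zero_imp_coeff_zero[OF assms(1-3), of "\<lambda>k. y $ k"] by blast
    then show False using \<open>y \<noteq> 0\<close> by (simp add: vec_eq_iff)
  qed
qed

text \<open>For fixed \<open>t\<close> the moment vectors of continuous positive densities form a convex cone, to
  which the dual description of the interior applies directly. A functional that is nonnegative on
  it defines a generalized polynomial that is nonnegative on the range \<open>[a, b]\<close> of \<open>t\<close>, hence it is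
  positive at every interior point of the moment cone.\<close>

lemma density_with_moments:
  fixes e :: "'k::finite \<Rightarrow> real" and t :: "'a::euclidean_space \<Rightarrow> real"
  assumes "0 < a" "a \<le> b"
    and t: "continuous_on (sphere 0 1) t" "t ` sphere 0 1 = {a..b}"
    and w: "w \<in> interior (moment_cone e a b)"
  obtains g where "continuous_on (sphere 0 1) g" "\<And>u. u \<in> sphere 0 1 \<Longrightarrow> 0 < g u"
    "\<And>k. w $ k = (LINT u|sphere_measure. t u powr e k * g u)"
proof -
  have tpos: "0 < t u" if "u \<in> sphere 0 1" for u
    using t(2) that \<open>0 < a\<close> by (metis atLeastAtMost_iff imageI less_le_trans)
  define M where "M g = (\<chi> k. LINT u|sphere_measure. t u powr e k * g u)" for g
  define G where "G = {g. continuous_on (sphere (0::'a) 1) g \<and> (\<forall>u\<in>sphere 0 1. 0 < (g u :: real))}"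
  have int: "integrable sphere_measure (\<lambda>u. t u powr e k * g u)" if "g \<in> G" for g k
    using t(1) tpos that by (intro integrable_sphere_measure continuous_intros)
      (auto simp: G_def less_imp_neq[symmetric])
  have "w \<in> interior (M ` G)"
  proof (rule interior_convex_cone_iff[THEN iffD2])
    have "(\<lambda>_. 1) \<in> G" by (simp add: G_def)
    then show "M ` G \<noteq> {}" by blast
  next
    fix x y assume "x \<in> M ` G" "y \<in> M ` G"
    then obtain g h where gh: "g \<in> G" "h \<in> G" "x = M g" "y = M h" by blast
    then have "x + y = M (\<lambda>u. g u + h u)"
      using int by (simp add: M_def vec_eq_iff distrib_left)
    moreover have "(\<lambda>u. g u + h u) \<in> G"
      using gh by (auto simp: G_def intro!: continuous_intros add_pos_pos)
    ultimately show "x + y \<in> M ` G" by blast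
  next
    fix c :: real and x assume "0 < c" "x \<in> M ` G"
    then obtain g where g: "g \<in> G" "x = M g" by blast
    then have "c *\<^sub>R x = M (\<lambda>u. c * g u)"
      by (simp add: M_def vec_eq_iff mult.left_commute[of _ c])
    moreover have "(\<lambda>u. c * g u) \<in> G"
      using g \<open>0 < c\<close> by (auto simp: G_def intro!: continuous_intros)
    ultimately show "c *\<^sub>R x \<in> M ` G" by blast
  next
    show "\<forall>y. y \<noteq> 0 \<longrightarrow> (\<forall>x\<in>M ` G. 0 \<le> y \<bullet> x) \<longrightarrow> 0 < y \<bullet> w"
    proof (intro allI impI)
      fix y assume "y \<noteq> 0" and y: "\<forall>x\<in>M ` G. 0 \<le> y \<bullet> x"
      let ?f = "\<lambda>s. \<Sum>k\<in>UNIV. y $ k * s powr e k"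
      have ft: "0 \<le> ?f (t u)" if "u \<in> sphere 0 1" for u
      proof (rule nonneg_if_sphere_integrals_nonneg[OF _ _ that])
        show "continuous_on (sphere 0 1) (\<lambda>u. ?f (t u))"
          by (rule continuous_on_powr_sum[OF t(1) tpos])
        fix g :: "'a \<Rightarrow> real"
        assume g: "continuous_on (sphere 0 1) g" "\<And>u. u \<in> sphere 0 1 \<Longrightarrow> 0 < g u"
        then have "0 \<le> y \<bullet> M g" using y by (simp add: G_def)
        also have "y \<bullet> M g = (LINT u|sphere_measure. ?f (t u) * g u)"
          by (rule inner_moment_vector[OF t(1) tpos g(1)]) (simp_all add: M_def)
        finally show "0 \<le> (LINT u|sphere_measure. ?f (t u) * g u)" .
      qed
      have "0 \<le> ?f s" if "a \<le> s" "s \<le> b" for s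
      proof -
        have "s \<in> t ` sphere 0 1" using that by (simp add: t(2))
        then obtain u where "u \<in> sphere 0 1" "s = t u" by blast
        then show ?thesis using ft by simp
      qed
      then show "0 < y \<bullet> w"
        using w \<open>y \<noteq> 0\<close> unfolding interior_moment_cone_iff[OF \<open>a \<le> b\<close>] by blast
    qed
  qed
  then have "w \<in> M ` G" using interior_subset by blast
  then show ?thesis by (auto simp: M_def G_def intro: that)
qed

text \<open>An affine function of one coordinate takes the values \<open>a\<close> and \<open>b\<close> at antipodal points, and
  the values in between because the sphere is connected.\<close>

lemma sphere_surjects_onto_interval:
  assumes "2 \<le> DIM('a::euclidean_space)" "a \<le> (b::real)"
  obtains t :: "'a::euclidean_space \<Rightarrow> real"
    where "continuous_on (sphere 0 1) t" "t ` sphere 0 1 = {a..b}"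
proof -
  obtain v :: 'a where "v \<in> Basis" using nonempty_Basis by blast
  then have v: "norm v = 1" "v \<bullet> v = 1" by (auto simp: norm_eq_1)
  define t where "t u = a + (b - a) * ((1 + u \<bullet> v) / 2)" for u
  have cont: "continuous_on (sphere 0 1) t" unfolding t_def by (intro continuous_intros) auto
  moreover have "t ` sphere 0 1 = {a..b}"
  proof
    show "t ` sphere 0 1 \<subseteq> {a..b}"
    proof (rule image_subsetI)
      fix u :: 'a assume "u \<in> sphere 0 1"
      then have "\<bar>u \<bullet> v\<bar> \<le> 1" using Cauchy_Schwarz_ineq2[of u v] v by simp
      then have c: "0 \<le> (1 + u \<bullet> v) / 2" "(1 + u \<bullet> v) / 2 \<le> 1" by auto
      have "0 \<le> (b - a) * ((1 + u \<bullet> v) / 2)"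
        using c(1) \<open>a \<le> b\<close> by (intro mult_nonneg_nonneg) auto
      moreover have "(b - a) * ((1 + u \<bullet> v) / 2) \<le> b - a"
        using c(2) \<open>a \<le> b\<close> by (intro mult_left_le) auto
      ultimately show "t u \<in> {a..b}" unfolding t_def atLeastAtMost_iff by linarith
    qed
    have "connected (t ` sphere 0 1)"
      using cont connected_sphere[OF assms(1)] by (rule connected_continuous_image)
    moreover have "t (- v) = a" "t v = b" using v by (simp_all add: t_def)
    then have "a \<in> t ` sphere 0 1" "b \<in> t ` sphere 0 1"
      using v(1) imageI[of "- v" "sphere 0 1" t] imageI[of v "sphere 0 1" t] by simp_all
    ultimately show "{a..b} \<subseteq> t ` sphere 0 1"
      by (rule connected_contains_Icc)
  qed
  ultimately show ?thesis by (rule that)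
qed

lemma three_increasing_values:
  fixes e :: "'k::finite \<Rightarrow> real"
  assumes "inj e" "3 \<le> CARD('k)"
  obtains k1 k2 k3 where "e k1 < e k2" "e k2 < e k3"
proof -
  obtain A :: "'k set" where "card A = 3"
    using obtain_subset_with_card_n[OF assms(2)] by blast
  then obtain x y z where "A = {x, y, z}" "x \<noteq> y" "y \<noteq> z" "x \<noteq> z"
    by (auto simp: card_3_iff)
  then have "e x \<noteq> e y" "e y \<noteq> e z" "e x \<noteq> e z"
    using \<open>inj e\<close> by (auto simp: inj_eq)
  then consider "e x < e y" "e y < e z" | "e x < e z" "e z < e y" | "e y < e x" "e x < e z"
    | "e y < e z" "e z < e x" | "e z < e x" "e x < e y" | "e z < e y" "e y < e x"
    by linarith
  then show ?thesis by cases (use that in blast)+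
qed

text \<open>The generalized polynomial with its only zero at \<open>l\<close> pairs to 0 with \<open>w\<close>, as \<open>w\<close> is a
  multiple of the vector of powers of \<open>l\<close>. Hence it vanishes at every value of \<open>t\<close>.\<close>

lemma moments_determine_constant:
  fixes e :: "'k::finite \<Rightarrow> real" and t g :: "'a::euclidean_space \<Rightarrow> real"
  assumes "inj e" "3 \<le> CARD('k)" "0 < l"
    and t: "continuous_on (sphere 0 1) t" "\<And>u. u \<in> sphere 0 1 \<Longrightarrow> 0 < t u"
    and g: "continuous_on (sphere 0 1) g" "\<And>u. u \<in> sphere 0 1 \<Longrightarrow> 0 < g u"
    and w: "\<And>k. w $ k = (LINT u|sphere_measure. t u powr e k * g u)"
    and wl: "\<And>k. w $ k = l powr e k * c"
    and u: "u \<in> sphere 0 1"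
  shows "t u = l"
proof -
  obtain k1 k2 k3 where k: "e k1 < e k2" "e k2 < e k3"
    by (rule three_increasing_values[OF assms(1,2)])
  then have ne: "k1 \<noteq> k2" "k2 \<noteq> k3" "k1 \<noteq> k3" by auto
  obtain A B C where
    zero: "A * l powr e k1 + B * l powr e k2 + C * l powr e k3 = 0" and
    pos: "\<And>s. 0 < s \<Longrightarrow> s \<noteq> l \<Longrightarrow> 0 < A * s powr e k1 + B * s powr e k2 + C * s powr e k3"
    by (rule three_term_powr_sum[OF k \<open>0 < l\<close>]) blast
  define y :: "real ^ 'k" where
    "y = (\<chi> k. if k = k1 then A else if k = k2 then B else if k = k3 then C else 0)"
  have sum_y: "(\<Sum>k\<in>UNIV. y $ k * z k) = A * z k1 + B * z k2 + C * z k3" for z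
  proof -
    have "(\<Sum>k\<in>UNIV. y $ k * z k) = (\<Sum>k\<in>{k1, k2, k3}. y $ k * z k)"
      by (intro sum.mono_neutral_right) (auto simp: y_def)
    then show ?thesis using ne by (simp add: y_def)
  qed
  have "y \<bullet> w = (A * l powr e k1 + B * l powr e k2 + C * l powr e k3) * c"
    by (simp add: inner_vec_def sum_y wl distrib_right mult.assoc)
  then have "y \<bullet> w \<le> 0" using zero by simp
  moreover have "0 \<le> (\<Sum>k\<in>UNIV. y $ k * t v powr e k)" if "v \<in> sphere 0 1" for v
    using pos[OF t(2)[OF that]] zero by (cases "t v = l") (auto simp: sum_y less_imp_le)
  ultimately have "(\<Sum>k\<in>UNIV. y $ k * t u powr e k) = 0"
    using powr_sum_zero_on_range_if_moment_le_zero[OF t g w _ _ u] by blast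
  then show ?thesis using pos[OF t(2)[OF u]] by (force simp: sum_y)
qed

lemma radial_quotient_and_density:
  fixes K L :: "'a::euclidean_space set"
  assumes "star_body K" "star_body L"
  defines "t \<equiv> (\<lambda>u. radial_fun L u / radial_fun K u)"
    and "g \<equiv> (\<lambda>u. radial_fun K u powr DIM('a) / DIM('a))"
  shows "continuous_on (sphere 0 1) t" "\<And>u. u \<in> sphere 0 1 \<Longrightarrow> 0 < t u"
    "continuous_on (sphere 0 1) g" "\<And>u. u \<in> sphere 0 1 \<Longrightarrow> 0 < g u"
    "\<And>i. dual_quermass i K L = (LINT u|sphere_measure. t u powr i * g u)"
proof -
  have K: "continuous_on (sphere 0 1) (radial_fun K)" "\<And>u. u \<in> sphere 0 1 \<Longrightarrow> 0 < radial_fun K u"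
    and L: "continuous_on (sphere 0 1) (radial_fun L)" "\<And>u. u \<in> sphere 0 1 \<Longrightarrow> 0 < radial_fun L u"
    using assms(1,2) by (auto simp: star_body_def)
  have Kne: "radial_fun K u \<noteq> 0" if "u \<in> sphere 0 1" for u
    using K(2)[OF that] by simp
  show "continuous_on (sphere 0 1) t" "continuous_on (sphere 0 1) g"
    unfolding t_def g_def using K(1) L(1) Kne by (auto intro!: continuous_intros)
  show "0 < t u" "0 < g u" if "u \<in> sphere 0 1" for u
    using K(2)[OF that] L(2)[OF that] by (auto simp: t_def g_def)
  show "dual_quermass i K L = (LINT u|sphere_measure. t u powr i * g u)" for i
    unfolding t_def g_def by (rule dual_quermass_eq_moment[OF assms(1,2)])
qed

text \<open>The alternative is whether the ratio of the radial functions is constant. If not, its range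
  is a nondegenerate interval \<open>[a, b]\<close>, which is the one to take for the moment cone.\<close>

lemma dual_quermass_interior_or_geometric:
  fixes K L :: "'a::euclidean_space set" and e :: "'k::finite \<Rightarrow> real"
  assumes "2 \<le> DIM('a)" "inj e" "e k0 = 0" and KL: "star_body K" "star_body L"
    and w: "\<And>k. dual_quermass (e k) K L = w $ k"
  shows "(\<exists>a b. 0 < a \<and> a < b \<and> w \<in> interior (moment_cone e a b)) \<or>
    (\<exists>l>0. \<forall>k. w $ k = l powr e k * w $ k0)"
proof -
  define t where "t u = radial_fun L u / radial_fun K u" for u
  define g where "g u = radial_fun K u powr DIM('a) / DIM('a)" for u
  note tg = radial_quotient_and_density[OF KL, folded t_def g_def]
  have wk: "w $ k = (LINT u|sphere_measure. t u powr e k * g u)" for k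
    using w[of k] tg(5)[of "e k"] by simp
  have "connected (t ` sphere 0 1) \<and> compact (t ` sphere 0 1)"
    using connected_sphere[OF assms(1)] tg(1)
    by (auto intro: connected_continuous_image compact_continuous_image)
  then obtain a b where ab: "t ` sphere 0 1 = {a..b}"
    using connected_compact_interval_1 by metis
  obtain v :: 'a where "v \<in> Basis" using nonempty_Basis by blast
  then have "t v \<in> t ` sphere 0 1" by simp
  then have "a \<le> b" by (simp add: ab)
  then have "a \<in> t ` sphere 0 1" by (simp add: ab)
  then have "0 < a" using tg(2) by blast
  show ?thesis
  proof (cases "a = b")
    case False
    with \<open>a \<le> b\<close> have "a < b" by simp
    with moments_in_interior_moment_cone[OF assms(2) \<open>0 < a\<close> this tg(1) ab tg(3,4) wk] \<open>0 < a\<close>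
    show ?thesis by blast
  next
    case True
    then have ta: "t u = a" if "u \<in> sphere 0 1" for u
      using ab that by (metis atLeastAtMost_singleton imageI singletonD)
    have "w $ k = (LINT u|sphere_measure. a powr e k * g u)" for k
      unfolding wk by (intro Bochner_Integration.integral_cong refl)
        (simp add: space_sphere_measure ta)
    then have "w $ k = a powr e k * w $ k0" for k
      using \<open>0 < a\<close> assms(3) by simp
    with \<open>0 < a\<close> show ?thesis by blast
  qed
qed

lemma star_bodies_if_interior_moment_cone:
  fixes e :: "'k::finite \<Rightarrow> real"
  assumes "2 \<le> DIM('a::euclidean_space)" "0 < a" "a < b" "w \<in> interior (moment_cone e a b)"
  shows "\<exists>K L :: 'a::euclidean_space set. star_body K \<and> star_body L \<and>
    (\<forall>k. dual_quermass (e k) K L = w $ k)"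
proof -
  obtain t :: "'a \<Rightarrow> real" where t: "continuous_on (sphere 0 1) t" "t ` sphere 0 1 = {a..b}"
    using sphere_surjects_onto_interval[OF assms(1)] \<open>a < b\<close> by (metis less_imp_le)
  obtain g where g: "continuous_on (sphere 0 1) g" "\<And>u. u \<in> sphere 0 1 \<Longrightarrow> 0 < g u"
    "\<And>k. w $ k = (LINT u|sphere_measure. t u powr e k * g u)"
    using density_with_moments[OF \<open>0 < a\<close> less_imp_le[OF \<open>a < b\<close>] t assms(4)] by blast
  have tpos: "0 < t u" if "u \<in> sphere 0 1" for u
    using t(2) that \<open>0 < a\<close> by (metis atLeastAtMost_iff imageI less_le_trans)
  show ?thesis
  proof (rule star_bodies_with_moments[OF t(1) tpos g(1,2)])
    fix p
    assume p: "star_body (star_with_radius p)" "star_body (star_with_radius (\<lambda>u. t u * p u))"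
      "\<And>i. dual_quermass i (star_with_radius p) (star_with_radius (\<lambda>u. t u * p u)) =
        (LINT u|sphere_measure. t u powr i * g u)"
    have "\<forall>k. dual_quermass (e k) (star_with_radius p) (star_with_radius (\<lambda>u. t u * p u)) = w $ k"
      unfolding p(3) g(3) by simp
    with p(1,2) show ?thesis by blast
  qed
qed

text \<open>A constant ratio \<open>t = l\<close> with a constant density: \<open>K\<close> is a ball.\<close>

lemma dilate_with_dual_quermass:
  fixes l c :: real
  assumes "0 < l" "0 < c"
  obtains K :: "'a::euclidean_space set"
    where "star_body K" "star_body ((\<lambda>x. l *\<^sub>R x) ` K)"
      "\<And>i. dual_quermass i K ((\<lambda>x. l *\<^sub>R x) ` K) = l powr i * c"
proof -
  define s where "s = measure sphere_measure (sphere (0::'a) 1)"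
  interpret finite_measure "sphere_measure :: 'a measure"
    by (rule finite_measure_sphere_measure)
  obtain v :: 'a where "v \<in> Basis" using nonempty_Basis by blast
  then have "emeasure sphere_measure (sphere (0::'a) 1) \<noteq> 0"
    using emeasure_sphere_measure_open_pos[OF open_UNIV UNIV_I, of v] by simp
  then have "s \<noteq> 0"
    unfolding s_def emeasure_eq_measure by auto
  then have "0 < s" by (simp add: s_def zero_less_measure_iff)
  obtain p :: "'a \<Rightarrow> real" where p:
    "star_body (star_with_radius p)" "star_body (star_with_radius (\<lambda>u. l * p u))"
    "\<And>i. dual_quermass i (star_with_radius p) (star_with_radius (\<lambda>u. l * p u)) =
      (LINT u|(sphere_measure :: 'a measure). l powr i * (c / s))"
    by (rule star_bodies_with_moments[of "\<lambda>_. l" "\<lambda>_. c / s"])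
      (use assms \<open>0 < s\<close> in auto)
  have "star_with_radius (\<lambda>u. l * p u) = (\<lambda>x. l *\<^sub>R x) ` star_with_radius p"
    by (rule star_with_radius_cmult) simp
  with p \<open>0 < s\<close> show ?thesis
    by (intro that[of "star_with_radius p"]) (auto simp: space_sphere_measure s_def)
qed

lemma dilate_if_geometric_dual_quermass:
  fixes K L :: "'a::euclidean_space set" and e :: "'k::finite \<Rightarrow> real"
  assumes "inj e" "3 \<le> CARD('k)" "0 < l" and KL: "star_body K" "star_body L"
    and w: "\<And>k. dual_quermass (e k) K L = l powr e k * c"
  shows "L = (\<lambda>x. l *\<^sub>R x) ` K"
proof -
  define W where "W = (\<chi> k. l powr e k * c)"
  note tg = radial_quotient_and_density[OF KL]
  have "radial_fun L u = l * radial_fun K u" if u: "u \<in> sphere 0 1" for u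
  proof -
    have "radial_fun L u / radial_fun K u = l"
      by (rule moments_determine_constant[OF assms(1-3) tg(1-4), where w=W])
        (use w u in \<open>auto simp: W_def tg(5)\<close>)
    moreover have "0 < radial_fun K u" using KL(1) u by (simp add: star_body_def)
    ultimately show ?thesis by (simp add: field_simps)
  qed
  then have "star_with_radius (radial_fun L) = (\<lambda>x. l *\<^sub>R x) ` star_with_radius (radial_fun K)"
    by (rule star_with_radius_cmult)
  then show ?thesis
    unfolding star_body_eq_star_with_radius[OF KL(1), symmetric]
      star_body_eq_star_with_radius[OF KL(2), symmetric] .
qed

section \<open>The characterization\<close>

theorem theorem1p1:
  fixes e :: "'k::finite \<Rightarrow> real" and k0 :: 'k and \<omega> :: "real ^ 'k"
  assumes "inj e" and "e k0 = 0"
    and "\<And>k. 0 < \<omega> $ k"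
    and "CARD('n::finite) \<ge> 2"
  shows "((\<exists>K L :: (real ^ 'n) set. star_body K \<and> star_body L \<and>
            (\<forall>k. dual_quermass (e k) K L = \<omega> $ k)) \<longleftrightarrow>
          ((\<exists>a b. 0 < a \<and> a < b \<and> \<omega> \<in> interior (moment_cone e a b)) \<or>
           (\<exists>l>0. \<forall>k. \<omega> $ k = l powr e k * \<omega> $ k0)))
       \<and> (\<forall>l>0. (\<forall>k. \<omega> $ k = l powr e k * \<omega> $ k0) \<longrightarrow>
            (\<exists>K L :: (real ^ 'n) set. star_body K \<and> star_body L \<and> L = (\<lambda>x. l *\<^sub>R x) ` K \<and>
               (\<forall>k. dual_quermass (e k) K L = \<omega> $ k)) \<and>
            (CARD('k) \<ge> 3 \<longrightarrow>
               (\<forall>K L :: (real ^ 'n) set. star_body K \<and> star_body L \<and>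
                  (\<forall>k. dual_quermass (e k) K L = \<omega> $ k) \<longrightarrow> L = (\<lambda>x. l *\<^sub>R x) ` K)))"
proof -
  have dim: "2 \<le> DIM(real ^ 'n)" using assms(4) by simp
  have geometric: "\<exists>K L :: (real ^ 'n) set. star_body K \<and> star_body L \<and> L = (\<lambda>x. l *\<^sub>R x) ` K \<and>
      (\<forall>k. dual_quermass (e k) K L = \<omega> $ k)"
    if l: "0 < l" "\<forall>k. \<omega> $ k = l powr e k * \<omega> $ k0" for l
  proof -
    obtain K :: "(real ^ 'n) set"
      where K: "star_body K" "star_body ((\<lambda>x. l *\<^sub>R x) ` K)"
        "\<And>i. dual_quermass i K ((\<lambda>x. l *\<^sub>R x) ` K) = l powr i * \<omega> $ k0"
      using dilate_with_dual_quermass[OF l(1) assms(3)] by blast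
    have "\<forall>k. dual_quermass (e k) K ((\<lambda>x. l *\<^sub>R x) ` K) = \<omega> $ k"
      by (intro allI trans[OF K(3) l(2)[rule_format, symmetric]])
    with K(1,2) show ?thesis by blast
  qed
  have dilate: "L = (\<lambda>x. l *\<^sub>R x) ` K"
    if l: "0 < l" "\<forall>k. \<omega> $ k = l powr e k * \<omega> $ k0" and card: "3 \<le> CARD('k)"
      and KL: "star_body K \<and> star_body L \<and> (\<forall>k. dual_quermass (e k) K L = \<omega> $ k)"
    for l and K L :: "(real ^ 'n) set"
  proof (rule dilate_if_geometric_dual_quermass[OF assms(1) card l(1)])
    show "star_body K" "star_body L" using KL by blast+
    show "dual_quermass (e k) K L = l powr e k * \<omega> $ k0" for k
      using KL l(2) by metis
  qed
  have existence: "(\<exists>K L :: (real ^ 'n) set. star_body K \<and> star_body L \<and>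
          (\<forall>k. dual_quermass (e k) K L = \<omega> $ k)) \<longleftrightarrow>
        ((\<exists>a b. 0 < a \<and> a < b \<and> \<omega> \<in> interior (moment_cone e a b)) \<or>
         (\<exists>l>0. \<forall>k. \<omega> $ k = l powr e k * \<omega> $ k0))"
  proof
    assume "\<exists>K L :: (real ^ 'n) set. star_body K \<and> star_body L \<and>
      (\<forall>k. dual_quermass (e k) K L = \<omega> $ k)"
    then obtain K L :: "(real ^ 'n) set"
      where KL: "star_body K" "star_body L" and w: "\<And>k. dual_quermass (e k) K L = \<omega> $ k"
      by blast
    show "(\<exists>a b. 0 < a \<and> a < b \<and> \<omega> \<in> interior (moment_cone e a b)) \<or>
        (\<exists>l>0. \<forall>k. \<omega> $ k = l powr e k * \<omega> $ k0)"
      by (rule dual_quermass_interior_or_geometric[OF dim assms(1,2) KL w])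
  next
    assume "(\<exists>a b. 0 < a \<and> a < b \<and> \<omega> \<in> interior (moment_cone e a b)) \<or>
        (\<exists>l>0. \<forall>k. \<omega> $ k = l powr e k * \<omega> $ k0)"
    then show "\<exists>K L :: (real ^ 'n) set. star_body K \<and> star_body L \<and>
        (\<forall>k. dual_quermass (e k) K L = \<omega> $ k)"
    proof (elim disjE exE conjE)
      fix a b assume "0 < a" "a < b" "\<omega> \<in> interior (moment_cone e a b)"
      then show ?thesis by (rule star_bodies_if_interior_moment_cone[OF dim])
    next
      fix l :: real assume "0 < l" "\<forall>k. \<omega> $ k = l powr e k * \<omega> $ k0"
      from geometric[OF this] show ?thesis by blast
    qed
  qed
  show ?thesis
    by (intro conjI allI impI existence) (rule geometric dilate, assumption+)+
qed

end
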